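(* Let $(X,\mathcal{M},\mu)$ be a complete, $\sigma$-finite measure space such that $L^2(X)$ is separable, let $\mathscr{H}$ be a separable Hilbert space, and let $\mathcal{A}$ be a countable dense subset of $L^2(X;\mathscr{H})$. Suppose that $W\subset L^2(X;\mathscr{H})$ is a closed subspace satisfying the orthogonality condition: for any $\xi\in L^2(X;\mathscr{H})$, $\xi\perp W$ implies $\xi(x)\perp J_W^{\mathcal{A}}(x)$ for a.e. $x$. Then $$P_W =\int_{X}^\oplus P_{J}(x)\,d\mu(x),$$ where $P_W$ is the orthogonal projection of $L^2(X;\mathscr{H})$ onto $W$ and $P_J(x)$ is the orthogonal projection from $\mathscr{H}$ onto $J_W^{\mathcal{A}}(x)$.
   Context: $L^2(X;\mathscr{H})$ is the Hilbert space of a.e.-classes of weakly measurable $\xi:X\to\mathscr{H}$ with $\int_X\|\xi(x)\|^2d\mu<\infty$. The range function $J_W^{\mathcal{A}}$: for each $\Phi\in\mathcal{A}$ choose an everywhere-defined representative $f(\Phi)$ of the class $P_W\Phi$, and let $J_W^{\mathcal{A}}(x)$ be the closed linear span in $\mathscr{H}$ of $\{f(\Phi)(x):\Phi\in\mathcal{A}\}$; up to a.e. equality it does not depend on the choice of representatives. Under the orthogonality condition, $x\mapsto P_J(x)$ is weakly measurable. The direct integral operator $\int_X^\oplus P_J(x)\,d\mu(x)$ sends $\xi$ to the function $x\mapsto P_J(x)\xi(x)$. *)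

theory Defs
  imports "HOL-Analysis.Analysis"
begin

section \<open>Complex Hilbert spaces\<close>

text \<open>
  The underlying real Hilbert space (norm, topology, completeness) comes from the superclasses;
  its inner product is the real part of \<open>cinner\<close>, which is linear in the first argument.
  Positive definiteness of \<open>cinner\<close> and the relation between \<open>cinner\<close> and the norm follow from
  \<open>Re_cinner\<close> and \<open>cinner_commute\<close>.
\<close>

class complex_hilbert_space = real_inner + complete_space +
  fixes scaleC :: "complex \<Rightarrow> 'a \<Rightarrow> 'a"
    and cinner :: "'a \<Rightarrow> 'a \<Rightarrow> complex"
  assumes scaleC_add_right: "scaleC a (x + y) = scaleC a x + scaleC a y"
    and scaleC_add_left: "scaleC (a + b) x = scaleC a x + scaleC b x"
    and scaleC_scaleC: "scaleC a (scaleC b x) = scaleC (a * b) x"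
    and scaleC_of_real: "scaleC (complex_of_real r) x = scaleR r x"
    and cinner_commute: "cinner x y = cnj (cinner y x)"
    and cinner_add_left: "cinner (x + y) z = cinner x z + cinner y z"
    and cinner_scaleC_left: "cinner (scaleC a x) y = a * cinner x y"
    and Re_cinner: "Re (cinner x y) = inner x y"

instantiation complex :: complex_hilbert_space
begin

definition scaleC_complex :: "complex \<Rightarrow> complex \<Rightarrow> complex"
  where "scaleC_complex a x = a * x"

definition cinner_complex :: "complex \<Rightarrow> complex \<Rightarrow> complex"
  where "cinner_complex x y = x * cnj y"

instance
  by standard
    (simp_all add: scaleC_complex_def cinner_complex_def algebra_simps scaleR_conv_of_real
      inner_complex_def)

end

global_interpretation complex_vector: vector_space
  "scaleC :: complex \<Rightarrow> 'a \<Rightarrow> 'a::complex_hilbert_space"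
  defines cspan = complex_vector.span
proof unfold_locales
  show "scaleC 1 x = x" for x :: 'a
    using scaleC_of_real[of 1 x] by simp
qed (simp_all add: scaleC_add_right scaleC_add_left scaleC_scaleC)

text \<open>Meaningful when \<open>V\<close> is a closed complex subspace.\<close>

definition orth_proj :: "'h::complex_hilbert_space set \<Rightarrow> 'h \<Rightarrow> 'h"
  where "orth_proj V x = (THE p. p \<in> V \<and> (\<forall>v\<in>V. cinner (x - p) v = 0))"


section \<open>The Hilbert space \<open>L\<^sup>2(X; H)\<close>\<close>

definition weakly_measurable :: "'x measure \<Rightarrow> ('x \<Rightarrow> 'h::complex_hilbert_space) \<Rightarrow> bool"
  where "weakly_measurable M f \<longleftrightarrow> (\<forall>v. (\<lambda>x. cinner (f x) v) \<in> borel_measurable M)"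

definition l2_fun :: "'x measure \<Rightarrow> ('x \<Rightarrow> 'h::complex_hilbert_space) set"
  where "l2_fun M = {f. weakly_measurable M f \<and> integrable M (\<lambda>x. (norm (f x))\<^sup>2)}"

text \<open>
  Elements of \<open>L\<^sup>2(X; H)\<close> are a.e.-classes, i.e. sets of functions. Functions are total on the
  type \<open>'x\<close>, but their values outside \<open>space M\<close> do not affect the class. Operations on classes are
  computed on the representatives picked by \<open>l2_rep\<close>.
\<close>

definition l2_class :: "'x measure \<Rightarrow> ('x \<Rightarrow> 'h::complex_hilbert_space) \<Rightarrow> ('x \<Rightarrow> 'h) set"
  where "l2_class M f = {g \<in> l2_fun M. AE x in M. g x = f x}"

definition L2 :: "'x measure \<Rightarrow> ('x \<Rightarrow> 'h::complex_hilbert_space) set set"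
  where "L2 M = l2_class M ` l2_fun M"

definition l2_rep :: "('x \<Rightarrow> 'h::complex_hilbert_space) set \<Rightarrow> 'x \<Rightarrow> 'h"
  where "l2_rep F = (SOME f. f \<in> F)"

definition l2_zero :: "'x measure \<Rightarrow> ('x \<Rightarrow> 'h::complex_hilbert_space) set"
  where "l2_zero M = l2_class M (\<lambda>x. 0)"

definition l2_add ::
  "'x measure \<Rightarrow> ('x \<Rightarrow> 'h::complex_hilbert_space) set \<Rightarrow> ('x \<Rightarrow> 'h) set \<Rightarrow> ('x \<Rightarrow> 'h) set"
  where "l2_add M F G = l2_class M (\<lambda>x. l2_rep F x + l2_rep G x)"

definition l2_diff ::
  "'x measure \<Rightarrow> ('x \<Rightarrow> 'h::complex_hilbert_space) set \<Rightarrow> ('x \<Rightarrow> 'h) set \<Rightarrow> ('x \<Rightarrow> 'h) set"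
  where "l2_diff M F G = l2_class M (\<lambda>x. l2_rep F x - l2_rep G x)"

definition l2_scale ::
  "'x measure \<Rightarrow> complex \<Rightarrow> ('x \<Rightarrow> 'h::complex_hilbert_space) set \<Rightarrow> ('x \<Rightarrow> 'h) set"
  where "l2_scale M c F = l2_class M (\<lambda>x. scaleC c (l2_rep F x))"

definition l2_inner ::
  "'x measure \<Rightarrow> ('x \<Rightarrow> 'h::complex_hilbert_space) set \<Rightarrow> ('x \<Rightarrow> 'h) set \<Rightarrow> complex"
  where "l2_inner M F G = (LINT x|M. cinner (l2_rep F x) (l2_rep G x))"

definition l2_dist ::
  "'x measure \<Rightarrow> ('x \<Rightarrow> 'h::complex_hilbert_space) set \<Rightarrow> ('x \<Rightarrow> 'h) set \<Rightarrow> real"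
  where "l2_dist M F G = sqrt (LINT x|M. (norm (l2_rep F x - l2_rep G x))\<^sup>2)"

definition l2_topology :: "'x measure \<Rightarrow> ('x \<Rightarrow> 'h::complex_hilbert_space) set topology"
  where "l2_topology M = Metric_space.mtopology (L2 M) (l2_dist M)"

definition l2_closed_subspace ::
  "'x measure \<Rightarrow> ('x \<Rightarrow> 'h::complex_hilbert_space) set set \<Rightarrow> bool"
  where "l2_closed_subspace M W \<longleftrightarrow>
    l2_zero M \<in> W \<and>
    (\<forall>F\<in>W. \<forall>G\<in>W. l2_add M F G \<in> W) \<and>
    (\<forall>c. \<forall>F\<in>W. l2_scale M c F \<in> W) \<and>
    closedin (l2_topology M) W"

definition l2_proj ::
  "'x measure \<Rightarrow> ('x \<Rightarrow> 'h::complex_hilbert_space) set set \<Rightarrow> ('x \<Rightarrow> 'h) set \<Rightarrow> ('x \<Rightarrow> 'h) set"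
  where "l2_proj M W F =
    (THE P. P \<in> W \<and> (\<forall>G\<in>W. l2_inner M (l2_diff M F P) G = 0))"


section \<open>Range functions and direct integrals\<close>

text \<open>
  Here \<open>f \<Phi>\<close> is intended to be an everywhere-defined representative of the projection of \<open>\<Phi>\<close>
  onto the subspace under consideration.
\<close>

definition range_function ::
  "('x \<Rightarrow> 'h::complex_hilbert_space) set set \<Rightarrow> (('x \<Rightarrow> 'h) set \<Rightarrow> 'x \<Rightarrow> 'h) \<Rightarrow> 'x \<Rightarrow> 'h set"
  where "range_function A f x = closure (cspan {f \<Phi> x | \<Phi>. \<Phi> \<in> A})"

definition orthogonality_condition ::
  "'x measure \<Rightarrow> ('x \<Rightarrow> 'h::complex_hilbert_space) set set \<Rightarrow> ('x \<Rightarrow> 'h set) \<Rightarrow> bool"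
  where "orthogonality_condition M W J \<longleftrightarrow>
    (\<forall>\<xi>\<in>L2 M. (\<forall>G\<in>W. l2_inner M \<xi> G = 0) \<longrightarrow>
      (AE x in M. \<forall>v\<in>J x. cinner (l2_rep \<xi> x) v = 0))"

text \<open>
  If \<open>x \<mapsto> T x (\<xi> x)\<close> is not a.e. equal to an \<open>L\<^sup>2\<close> function, the result is the empty set, which is
  not an element of \<open>L2 M\<close>.
\<close>

definition direct_integral ::
  "'x measure \<Rightarrow> ('x \<Rightarrow> 'h \<Rightarrow> 'h) \<Rightarrow> ('x \<Rightarrow> 'h::complex_hilbert_space) set \<Rightarrow> ('x \<Rightarrow> 'h) set"
  where "direct_integral M T \<xi> = l2_class M (\<lambda>x. T x (l2_rep \<xi> x))"

end

theory Submission
  imports Defs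
begin

text \<open>
  Fix \<open>\<xi>\<close> in \<open>L\<^sup>2(X; H)\<close> and let \<open>p\<close> be a representative of its projection onto \<open>W\<close>. A vector
  \<open>p(x)\<close> equals \<open>P\<^sub>J(x) \<xi>(x)\<close> as soon as \<open>p(x) \<in> J(x)\<close> and \<open>\<xi>(x) - p(x) \<bottom> J(x)\<close>
  (\<open>orth_proj_eqI\<close>), so it suffices to see both almost everywhere.

  The second holds by the orthogonality condition, because \<open>\<xi> - p\<close> is orthogonal to \<open>W\<close>. For the
  first, choose \<open>\<Phi>\<^sub>n\<close> in the dense set with \<open>\<parallel>\<Phi>\<^sub>n - \<xi>\<parallel>\<close> decreasing geometrically. Projection onto
  \<open>W\<close> is a contraction, so the representatives \<open>f(\<Phi>\<^sub>n)\<close> approach \<open>p\<close> at the same geometric rate;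
  then \<open>f(\<Phi>\<^sub>n)(x)\<close> converges to \<open>p(x)\<close> for almost every \<open>x\<close>, and these vectors lie in the closed
  set \<open>J(x)\<close> (\<open>projection_in_range_function\<close>).

  The projection onto \<open>W\<close> is defined by a description, so its existence has to be proved
  (\<open>projection_exists\<close>). The limit of a minimising sequence comes from a Riesz--Fischer argument for
  sequences that are Cauchy at a geometric rate (\<open>Riesz_Fischer\<close>). Functions here are only weakly
  measurable; separability of \<open>H\<close> enters to make their norms measurable (\<open>norm_sq_measurable\<close>).
\<close>

section \<open>Complex inner products through their real parts\<close>

lemma cinner_add_right: "cinner x (y + z) = cinner x y + cinner x z"
  by (metis cinner_add_left cinner_commute complex_cnj_add)

lemma cinner_zero_left [simp]: "cinner 0 x = 0"
  using cinner_add_left[of 0 0 x] by simp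

lemma cinner_diff_left: "cinner (x - y) z = cinner x z - cinner y z"
  by (metis add_diff_cancel cinner_add_left diff_add_cancel)

lemma cinner_diff_right: "cinner x (y - z) = cinner x y - cinner x z"
  by (metis add_diff_cancel cinner_add_right diff_add_cancel)

lemma cinner_self_eq_0: "cinner x x = 0 \<Longrightarrow> x = 0"
  by (metis Re_cinner inner_eq_zero_iff zero_complex.sel(1))

lemma inner_scaleC_ii: "inner x (scaleC \<i> y) = Im (cinner x y)"
proof -
  have "inner x (scaleC \<i> y) = Re (cinner (scaleC \<i> y) x)"
    by (metis Re_cinner inner_commute)
  also have "\<dots> = - Im (cinner y x)"
    by (simp add: cinner_scaleC_left)
  also have "\<dots> = Im (cinner x y)"
    by (subst (2) cinner_commute) simp
  finally show ?thesis .
qed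

lemma cinner_eq_Complex_inner: "cinner x y = Complex (inner x y) (inner x (scaleC \<i> y))"
  by (simp add: inner_scaleC_ii complex_eq_iff Re_cinner)

lemma norm_scaleC: "norm (scaleC c x) = cmod c * norm x"
proof -
  have "cinner (scaleC c x) (scaleC c x) = (c * cnj c) * cinner x x"
    by (metis cinner_commute cinner_scaleC_left complex_cnj_mult mult.assoc)
  then have "Re (cinner (scaleC c x) (scaleC c x)) = (cmod c)\<^sup>2 * Re (cinner x x)"
    by (simp add: complex_mult_cnj cmod_power2)
  then have "(norm (scaleC c x))\<^sup>2 = (cmod c * norm x)\<^sup>2"
    by (simp add: Re_cinner power2_norm_eq_inner power_mult_distrib)
  then show ?thesis by (simp add: power2_eq_iff_nonneg)
qed

lemma orth_proj_eqI:
  assumes "p \<in> V" and "\<And>v. v \<in> V \<Longrightarrow> cinner (x - p) v = 0"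
  shows "orth_proj V x = p"
  unfolding orth_proj_def
proof (rule the_equality)
  fix q assume q: "q \<in> V \<and> (\<forall>v\<in>V. cinner (x - q) v = 0)"
  have "cinner ((x - q) - (x - p)) (p - q)
      = (cinner (x - q) p - cinner (x - q) q) - (cinner (x - p) p - cinner (x - p) q)"
    unfolding cinner_diff_left[of "x - q" "x - p"] cinner_diff_right by algebra
  also have "\<dots> = 0" using assms q by simp
  finally have "cinner ((x - q) - (x - p)) (p - q) = 0" .
  then have "cinner (p - q) (p - q) = 0" by simp
  from cinner_self_eq_0[OF this] show "q = p" by simp
qed (use assms in auto)

text \<open>
  This serves twice: it gives Cauchy--Schwarz when the quadratic is \<open>\<parallel>f + t g\<parallel>\<^sup>2\<close>, and the
  orthogonality of the error at a nearest point when \<open>a = 0\<close>, where it forces \<open>b = 0\<close>.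
\<close>

lemma nonneg_quadratic_discriminant:
  fixes a b c :: real
  assumes "\<And>t. 0 \<le> a + 2 * t * b + t\<^sup>2 * c"
  shows "b\<^sup>2 \<le> a * c"
proof (cases "c = 0")
  case True
  have "b = 0"
  proof (rule ccontr)
    assume "b \<noteq> 0"
    \<comment> \<open>At this point the affine function \<open>a + 2 t b\<close> takes the value \<open>-1\<close>.\<close>
    then show False using assms[of "- (a + 1) / (2 * b)"] True by (simp add: field_simps)
  qed
  then show ?thesis using True by simp
next
  case False
  have "c > 0"
  proof (rule ccontr)
    assume "\<not> c > 0"
    then have c: "c < 0" using False by simp
    \<comment> \<open>Adding the values at \<open>t\<close> and \<open>- t\<close> removes the linear term.\<close>
    define t where "t = sqrt ((\<bar>a\<bar> + 1) / (- c))"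
    have "t\<^sup>2 * c = - (\<bar>a\<bar> + 1)" using c by (simp add: t_def field_simps)
    then show False using assms[of t] assms[of "-t"] by (simp add: algebra_simps)
  qed
  then show ?thesis using assms[of "- b / c"]
    by (simp add: field_simps power2_eq_square)
qed


section \<open>Square-integrable functions with values in a separable Hilbert space\<close>

definition l2sq :: "'x measure \<Rightarrow> ('x \<Rightarrow> 'h::complex_hilbert_space) \<Rightarrow> real"
  where "l2sq M f = (LINT x|M. (norm (f x))\<^sup>2)"

definition l2ip :: "'x measure \<Rightarrow> ('x \<Rightarrow> 'h::complex_hilbert_space) \<Rightarrow> ('x \<Rightarrow> 'h) \<Rightarrow> real"
  where "l2ip M f g = (LINT x|M. inner (f x) (g x))"

locale separable_hilbert_L2 =
  fixes M :: "'x measure" and D :: "'h::complex_hilbert_space set"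
  assumes countable_D: "countable D" and dense_D: "closure D = UNIV"
begin

text \<open>
  The number \<open>\<parallel>y\<parallel>\<^sup>2\<close> is the supremum of \<open>2 Re \<langle>y, v\<rangle> - \<parallel>v\<parallel>\<^sup>2 = \<parallel>y\<parallel>\<^sup>2 - \<parallel>y - v\<parallel>\<^sup>2\<close> over \<open>v\<close>, and by
  density countably many \<open>v\<close> suffice; so weak measurability is enough for the norm to be measurable.
\<close>

lemma norm_sq_le_iff_dense: "(norm y)\<^sup>2 \<le> a \<longleftrightarrow> (\<forall>v\<in>D. 2 * inner y v - (norm v)\<^sup>2 \<le> a)"
proof
  assume "(norm y)\<^sup>2 \<le> a"
  moreover have "2 * inner y v - (norm v)\<^sup>2 \<le> (norm y)\<^sup>2" for v
    using zero_le_power2[of "norm (y - v)"] unfolding dot_norm_neg[of y v] by argo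
  ultimately show "\<forall>v\<in>D. 2 * inner y v - (norm v)\<^sup>2 \<le> a" by (meson order_trans)
next
  assume D: "\<forall>v\<in>D. 2 * inner y v - (norm v)\<^sup>2 \<le> a"
  have "closed {v. 2 * inner y v - (norm v)\<^sup>2 \<le> a}"
    by (intro closed_Collect_le continuous_intros)
  with D have "closure D \<subseteq> {v. 2 * inner y v - (norm v)\<^sup>2 \<le> a}"
    by (intro closure_minimal) auto
  then have "2 * inner y y - (norm y)\<^sup>2 \<le> a" using dense_D by auto
  then show "(norm y)\<^sup>2 \<le> a" by (simp add: power2_norm_eq_inner)
qed

lemma weakly_measurable_inner:
  assumes "weakly_measurable M f"
  shows "(\<lambda>x. inner (f x) v) \<in> borel_measurable M"
proof -
  have [measurable]: "(\<lambda>x. cinner (f x) v) \<in> borel_measurable M"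
    using assms unfolding weakly_measurable_def by blast
  have "(\<lambda>x. Re (cinner (f x) v)) \<in> borel_measurable M" by measurable
  then show ?thesis by (simp add: Re_cinner)
qed

lemma norm_sq_measurable:
  assumes f: "weakly_measurable M f"
  shows "(\<lambda>x. (norm (f x :: 'h))\<^sup>2) \<in> borel_measurable M"
  unfolding borel_measurable_iff_le
proof
  fix a :: real
  have "D \<noteq> {}" using dense_D by auto
  have "{w \<in> space M. (norm (f w))\<^sup>2 \<le> a}
      = (\<Inter>v\<in>D. {w \<in> space M. 2 * inner (f w) v - (norm v)\<^sup>2 \<le> a})"
    using \<open>D \<noteq> {}\<close> by (auto simp: norm_sq_le_iff_dense)
  also have "\<dots> \<in> sets M"
  proof (intro sets.countable_INT' countable_D)
    show "D \<noteq> {}" by fact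
    have "{w \<in> space M. 2 * inner (f w) v - (norm v)\<^sup>2 \<le> a} \<in> sets M" for v
      using weakly_measurable_inner[OF f, of v] by measurable
    then show "(\<lambda>v. {w \<in> space M. 2 * inner (f w) v - (norm v)\<^sup>2 \<le> a}) ` D \<subseteq> sets M" by blast
  qed
  finally show "{w \<in> space M. (norm (f w))\<^sup>2 \<le> a} \<in> sets M" .
qed

lemma weakly_measurable_add:
  "weakly_measurable M f \<Longrightarrow> weakly_measurable M g \<Longrightarrow> weakly_measurable M (\<lambda>x. f x + g x)"
  unfolding weakly_measurable_def cinner_add_left by (intro allI borel_measurable_add) blast+

lemma weakly_measurable_diff:
  "weakly_measurable M f \<Longrightarrow> weakly_measurable M g \<Longrightarrow> weakly_measurable M (\<lambda>x. f x - g x)"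
  unfolding weakly_measurable_def cinner_diff_left by (intro allI borel_measurable_diff) blast+

lemma weakly_measurable_scaleC:
  "weakly_measurable M f \<Longrightarrow> weakly_measurable M (\<lambda>x. scaleC c (f x))"
  unfolding weakly_measurable_def cinner_scaleC_left
  by (intro allI borel_measurable_times borel_measurable_const) blast+

lemma l2_fun_zero: "(\<lambda>x. 0) \<in> l2_fun M"
  by (simp add: l2_fun_def weakly_measurable_def)

lemma l2_fun_scaleC: "f \<in> l2_fun M \<Longrightarrow> (\<lambda>x. scaleC c (f x)) \<in> l2_fun M"
  by (auto simp: l2_fun_def weakly_measurable_scaleC norm_scaleC power_mult_distrib)

lemma l2_fun_add:
  assumes "f \<in> l2_fun M" "g \<in> l2_fun M"
  shows "(\<lambda>x. f x + g x :: 'h) \<in> l2_fun M"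
proof -
  have wm: "weakly_measurable M (\<lambda>x. f x + g x)"
    using assms by (intro weakly_measurable_add) (auto simp: l2_fun_def)
  have "integrable M (\<lambda>x. (norm (f x + g x))\<^sup>2)"
  proof (rule Bochner_Integration.integrable_bound)
    show "integrable M (\<lambda>x. 2 * (norm (f x))\<^sup>2 + 2 * (norm (g x))\<^sup>2)"
      using assms by (auto simp: l2_fun_def)
    have "(norm (a + b))\<^sup>2 \<le> 2 * (norm a)\<^sup>2 + 2 * (norm b)\<^sup>2" for a b :: 'h
      using zero_le_power2[of "norm (a - b)"] dot_norm[of a b] dot_norm_neg[of a b] by argo
    then show "AE x in M. norm ((norm (f x + g x))\<^sup>2)
        \<le> norm (2 * (norm (f x))\<^sup>2 + 2 * (norm (g x))\<^sup>2)" by auto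
  qed (rule norm_sq_measurable[OF wm])
  with wm show ?thesis by (simp add: l2_fun_def)
qed

lemma l2_fun_scaleR: "f \<in> l2_fun M \<Longrightarrow> (\<lambda>x. t *\<^sub>R f x) \<in> l2_fun M"
  using l2_fun_scaleC[of f "complex_of_real t"] by (simp add: scaleC_of_real)

lemma l2_fun_diff:
  assumes "f \<in> l2_fun M" "g \<in> l2_fun M"
  shows "(\<lambda>x. f x - g x :: 'h) \<in> l2_fun M"
  using l2_fun_add[OF assms(1) l2_fun_scaleR[OF assms(2), of "-1"]] by simp

lemma l2sq_nonneg: "0 \<le> l2sq M f"
  by (simp add: l2sq_def)

lemma l2sq_integrable: "f \<in> l2_fun M \<Longrightarrow> integrable M (\<lambda>x. (norm (f x))\<^sup>2)"
  by (simp add: l2_fun_def)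

lemma l2ip_integrable:
  assumes "f \<in> l2_fun M" "g \<in> l2_fun M"
  shows "integrable M (\<lambda>x. inner (f x) (g x :: 'h))"
  unfolding dot_norm
  using l2sq_integrable[OF assms(1)] l2sq_integrable[OF assms(2)]
    l2sq_integrable[OF l2_fun_add[OF assms]] by auto

lemma l2sq_add_scaleR:
  assumes "f \<in> l2_fun M" "g \<in> l2_fun M"
  shows "l2sq M (\<lambda>x. f x + t *\<^sub>R g x :: 'h) = l2sq M f + 2 * t * l2ip M f g + t\<^sup>2 * l2sq M g"
proof -
  have "(norm (f x + t *\<^sub>R g x))\<^sup>2
      = (norm (f x))\<^sup>2 + 2 * t * inner (f x) (g x) + t\<^sup>2 * (norm (g x))\<^sup>2" for x
    unfolding power2_norm_eq_inner
    by (simp add: inner_commute power2_eq_square algebra_simps)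
  then show ?thesis
    using assms by (simp add: l2sq_def l2ip_def l2sq_integrable l2ip_integrable)
qed

lemma l2ip_cong_AE:
  assumes "f \<in> l2_fun M" "g \<in> l2_fun M" "f' \<in> l2_fun M" "g' \<in> l2_fun M"
    and "AE x in M. f x = f' x" "AE x in M. g x = g' x"
  shows "l2ip M f g = l2ip M f' (g' :: 'x \<Rightarrow> 'h)"
  unfolding l2ip_def
  by (rule integral_cong_AE)
    (use assms in \<open>auto intro: borel_measurable_integrable l2ip_integrable\<close>)

lemma l2sq_cong_AE:
  assumes "f \<in> l2_fun M" "f' \<in> l2_fun M" "AE x in M. f x = f' x"
  shows "l2sq M f = l2sq M (f' :: 'x \<Rightarrow> 'h)"
  unfolding l2sq_def
  by (rule integral_cong_AE)
    (use assms in \<open>auto intro: borel_measurable_integrable l2sq_integrable\<close>)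

lemma l2sq_eq_0_iff:
  assumes "f \<in> l2_fun M"
  shows "l2sq M f = 0 \<longleftrightarrow> (AE x in M. f x = (0 :: 'h))"
  unfolding l2sq_def using integral_nonneg_eq_0_iff_AE[OF l2sq_integrable[OF assms]] by simp

lemma l2ip_diff_left:
  assumes "f \<in> l2_fun M" "g \<in> l2_fun M" "h \<in> l2_fun M"
  shows "l2ip M (\<lambda>x. f x - g x) h = l2ip M f h - l2ip M g (h :: 'x \<Rightarrow> 'h)"
  using assms by (simp add: l2ip_def inner_diff_left l2ip_integrable)

lemma Minkowski:
  assumes "f \<in> l2_fun M" "g \<in> l2_fun M"
  shows "sqrt (l2sq M (\<lambda>x. f x + g x :: 'h)) \<le> sqrt (l2sq M f) + sqrt (l2sq M g)"
proof -
  have "0 \<le> l2sq M f + 2 * t * l2ip M f g + t\<^sup>2 * l2sq M g" for t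
    using l2sq_add_scaleR[OF assms, of t] by (metis l2sq_nonneg)
  then have "(l2ip M f g)\<^sup>2 \<le> l2sq M f * l2sq M g"
    by (rule nonneg_quadratic_discriminant)
  then have "l2ip M f g \<le> sqrt (l2sq M f) * sqrt (l2sq M g)"
    by (simp add: real_le_rsqrt flip: real_sqrt_mult)
  then have "l2sq M (\<lambda>x. f x + g x) \<le> (sqrt (l2sq M f) + sqrt (l2sq M g))\<^sup>2"
    using l2sq_add_scaleR[OF assms, of 1] by (simp add: power2_sum l2sq_nonneg)
  then show ?thesis by (intro real_le_lsqrt) (auto simp: l2sq_nonneg)
qed


section \<open>Completeness\<close>

text \<open>
  The bounds may vary with \<open>n\<close> because the squared distances along a minimising sequence only tend to
  the infimum.
\<close>

lemma Fatou_l2: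
  assumes v: "\<And>n. v n \<in> l2_fun M" and w: "weakly_measurable M w"
    and lim: "AE x in M. (\<lambda>n. v n x) \<longlonglongrightarrow> (w x :: 'h)"
    and bound: "\<And>n. l2sq M (v n) \<le> c n" and c: "c \<longlonglongrightarrow> C"
  shows "w \<in> l2_fun M" "l2sq M w \<le> C"
proof -
  have "(\<integral>\<^sup>+x. ennreal ((norm (w x))\<^sup>2) \<partial>M)
      = (\<integral>\<^sup>+x. liminf (\<lambda>n. ennreal ((norm (v n x))\<^sup>2)) \<partial>M)"
  proof (rule nn_integral_cong_AE, use lim in eventually_elim)
    case (elim x)
    then have "(\<lambda>n. ennreal ((norm (v n x))\<^sup>2)) \<longlonglongrightarrow> ennreal ((norm (w x))\<^sup>2)"
      by (intro tendsto_intros)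
    then show ?case by (intro lim_imp_Liminf[symmetric]) auto
  qed
  also have "\<dots> \<le> liminf (\<lambda>n. \<integral>\<^sup>+x. ennreal ((norm (v n x))\<^sup>2) \<partial>M)"
    by (rule nn_integral_liminf) (use v in \<open>auto simp: l2_fun_def\<close>)
  also have "\<dots> = liminf (\<lambda>n. ennreal (l2sq M (v n)))"
    by (simp add: nn_integral_eq_integral l2sq_integrable v l2sq_def)
  also have "\<dots> \<le> liminf (\<lambda>n. ennreal (c n))"
    by (intro Liminf_mono always_eventually allI ennreal_leI bound)
  also have "\<dots> = ennreal C"
    using c by (intro lim_imp_Liminf tendsto_ennrealI) auto
  finally have le: "(\<integral>\<^sup>+x. ennreal ((norm (w x))\<^sup>2) \<partial>M) \<le> ennreal C" .
  have int: "integrable M (\<lambda>x. (norm (w x))\<^sup>2)"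
    using le_less_trans[OF le] norm_sq_measurable[OF w]
    by (intro integrableI_bounded) auto
  then show "w \<in> l2_fun M" using w by (simp add: l2_fun_def)
  have "0 \<le> c n" for n using l2sq_nonneg[of "v n"] bound[of n] by simp
  then have "0 \<le> C" by (intro LIMSEQ_le_const[OF c]) blast
  then show "l2sq M w \<le> C"
    using le int by (simp add: l2sq_def nn_integral_eq_integral)
qed

text \<open>
  The weight \<open>2\<^sup>n\<close> grows slowly enough for the integrals of the terms to stay summable, while
  finiteness of the weighted sum at a point makes \<open>\<parallel>g\<^sub>n(x)\<parallel>\<close> decay geometrically there. This turns
  decay in mean into almost everywhere decay of the whole sequence.
\<close>

lemma AE_summable_of_fast_decay:
  assumes g: "\<And>n. g n \<in> l2_fun M" and bound: "\<And>n. l2sq M (g n) \<le> (1/4)^n"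
  shows "AE x in M. (\<Sum>n. ennreal (2^n * (norm (g n x :: 'h))\<^sup>2)) \<noteq> \<infinity>"
proof (rule nn_integral_PInf_AE)
  have meas: "(\<lambda>x. ennreal (2^n * (norm (g n x))\<^sup>2)) \<in> borel_measurable M" for n
    using borel_measurable_integrable[OF l2sq_integrable[OF g]]
    by (intro measurable_compose[OF _ measurable_ennreal] borel_measurable_times) auto
  then show "(\<lambda>x. \<Sum>n. ennreal (2^n * (norm (g n x))\<^sup>2)) \<in> borel_measurable M"
    by (rule borel_measurable_suminf_order)
  have "(\<integral>\<^sup>+x. (\<Sum>n. ennreal (2^n * (norm (g n x))\<^sup>2)) \<partial>M)
      = (\<Sum>n. \<integral>\<^sup>+x. ennreal (2^n * (norm (g n x))\<^sup>2) \<partial>M)"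
    by (intro nn_integral_suminf meas)
  also have "\<dots> = (\<Sum>n. ennreal (2^n * l2sq M (g n)))"
    by (simp add: nn_integral_eq_integral l2sq_integrable g l2sq_def)
  also have "\<dots> \<le> (\<Sum>n. ennreal ((1/2)^n))"
  proof (intro suminf_le ennreal_leI)
    fix n
    have "2^n * l2sq M (g n) \<le> 2^n * (1/4)^n" using bound by (intro mult_left_mono) auto
    also have "\<dots> = (1/2)^n" by (simp flip: power_mult_distrib)
    finally show "2^n * l2sq M (g n) \<le> (1/2)^n" .
  qed auto
  also have "\<dots> = ennreal (\<Sum>n. (1/2)^n)"
    by (intro suminf_ennreal2) (auto intro: summable_geometric)
  finally show "(\<integral>\<^sup>+x. (\<Sum>n. ennreal (2^n * (norm (g n x))\<^sup>2)) \<partial>M) \<noteq> \<infinity>"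
    by (auto simp: top_unique)
qed

end

lemma norm_geometric_of_weighted_sum:
  fixes a :: "nat \<Rightarrow> 'h::real_normed_vector"
  assumes "(\<Sum>n. ennreal (2^n * (norm (a n))\<^sup>2)) \<noteq> \<infinity>"
  obtains B where "\<And>n. norm (a n) \<le> B * sqrt (1/2)^n"
proof -
  define S where "S = enn2real (\<Sum>n. ennreal (2^n * (norm (a n))\<^sup>2))"
  have S: "ennreal S = (\<Sum>n. ennreal (2^n * (norm (a n))\<^sup>2))"
    using assms by (simp add: S_def less_top)
  have "2^n * (norm (a n))\<^sup>2 \<le> S" for n
  proof -
    have "ennreal (2^n * (norm (a n))\<^sup>2) = (\<Sum>i\<in>{n}. ennreal (2^i * (norm (a i))\<^sup>2))" by simp
    also have "\<dots> \<le> ennreal S" unfolding S by (rule sum_le_suminf) auto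
    finally show ?thesis by (simp add: S_def)
  qed
  then have "(norm (a n))\<^sup>2 \<le> S * (1/2)^n" for n
    by (simp add: field_simps)
  then have "norm (a n) \<le> sqrt (S * (1/2)^n)" for n
    by (rule real_le_rsqrt)
  then show ?thesis
    by (intro that[of "sqrt S"]) (simp add: real_sqrt_mult real_sqrt_power)
qed

lemma convergent_of_geometric_increments:
  fixes a :: "nat \<Rightarrow> 'h::complex_hilbert_space"
  assumes a: "\<And>n. norm (a (Suc n) - a n) \<le> B * r^n" and r: "0 \<le> r" "r < 1"
  shows "convergent a"
proof -
  have "Cauchy a"
  proof (rule metric_CauchyI)
    fix e :: real assume e: "0 < e"
    have B: "0 \<le> B" using order_trans[OF norm_ge_zero a[of 0]] by simp
    have tele: "norm (a (m + k) - a m) \<le> B * r^m / (1 - r)" for m k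
    proof -
      have "norm (a (m + k) - a m) = norm (\<Sum>i<k. a (m + Suc i) - a (m + i))"
        by (subst sum_lessThan_telescope[of "\<lambda>i. a (m + i)"]) simp
      also have "\<dots> \<le> (\<Sum>i<k. B * r^m * r^i)"
        by (intro sum_norm_le, use a[of "m + _"] in \<open>simp add: power_add mult.assoc\<close>)
      also have "\<dots> = B * r^m * (\<Sum>i<k. r^i)" by (simp add: sum_distrib_left)
      also have "\<dots> \<le> B * r^m * (1 / (1 - r))"
      proof (rule mult_left_mono)
        show "(\<Sum>i<k. r^i) \<le> 1 / (1 - r)"
          using r by (simp add: sum_gp_strict divide_right_mono)
      qed (use B r in auto)
      finally show ?thesis by simp
    qed
    have "(\<lambda>m. B * r^m / (1 - r)) \<longlonglongrightarrow> B * 0 / (1 - r)"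
      using r by (intro tendsto_intros LIMSEQ_power_zero) auto
    then have "\<forall>\<^sub>F m in sequentially. B * r^m / (1 - r) < e / 2"
      using e by (intro order_tendstoD) auto
    then obtain N where N: "B * r^N / (1 - r) < e / 2"
      by (auto simp: eventually_sequentially)
    have close: "dist (a n) (a N) < e / 2" if "n \<ge> N" for n
      using order.strict_trans1[OF tele[of N "n - N"] N] that by (simp add: dist_norm)
    have "dist (a m) (a n) < e" if "m \<ge> N" "n \<ge> N" for m n
      using close[OF that(1)] close[OF that(2)] by (rule dist_triangle_half_l)
    then show "\<exists>N. \<forall>m\<ge>N. \<forall>n\<ge>N. dist (a m) (a n) < e" by blast
  qed
  then show ?thesis by (rule Cauchy_convergent)
qed

context separable_hilbert_L2
begin

text \<open>
  The limit is formed on the measurable set where the weighted sum of increments is finite, with the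
  sequence replaced by \<open>0\<close> elsewhere: the modified sequence converges everywhere, so weak
  measurability passes to the limit with no exceptional set.
\<close>

lemma Riesz_Fischer:
  assumes v: "\<And>n. v n \<in> l2_fun M"
    and fast: "\<And>n m. n \<le> m \<Longrightarrow> l2sq M (\<lambda>x. v m x - v n x) \<le> (1/4)^n"
  obtains p where "p \<in> l2_fun M" "AE x in M. (\<lambda>n. v n x) \<longlonglongrightarrow> (p x :: 'h)"
    "\<And>n. l2sq M (\<lambda>x. p x - v n x) \<le> (1/4)^n"
proof -
  define G where "G x = (\<Sum>n. ennreal (2^n * (norm (v (Suc n) x - v n x))\<^sup>2))" for x
  define w where "w n x = (if G x \<noteq> \<infinity> then v n x else 0)" for n x
  define p where "p x = lim (\<lambda>n. w n x)" for x
  have incr: "(\<lambda>x. v (Suc n) x - v n x) \<in> l2_fun M" for n by (intro l2_fun_diff v)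
  have AE_G: "AE x in M. G x \<noteq> \<infinity>"
    unfolding G_def by (rule AE_summable_of_fast_decay[OF incr]) (rule fast, simp)
  have G_meas[measurable]: "G \<in> borel_measurable M"
    using borel_measurable_integrable[OF l2sq_integrable[OF incr]] unfolding G_def
    by (intro borel_measurable_suminf_order measurable_compose[OF _ measurable_ennreal]
        borel_measurable_times) auto
  have wlim: "(\<lambda>n. w n x) \<longlonglongrightarrow> p x" for x
  proof (cases "G x \<noteq> \<infinity>")
    case True
    then obtain B where "\<And>n. norm (v (Suc n) x - v n x) \<le> B * sqrt (1/2)^n"
      using norm_geometric_of_weighted_sum[of "\<lambda>n. v (Suc n) x - v n x"] unfolding G_def by metis
    then have "convergent (\<lambda>n. v n x)"
      by (rule convergent_of_geometric_increments) (auto simp: real_sqrt_lt_1_iff)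
    then show ?thesis using True by (simp add: p_def w_def convergent_LIMSEQ_iff)
  next
    case False
    then show ?thesis by (simp add: p_def w_def lim_const)
  qed
  have w_meas: "(\<lambda>x. cinner (w n x) u) \<in> borel_measurable M" for n u
  proof -
    have [measurable]: "(\<lambda>x. cinner (v n x) u) \<in> borel_measurable M"
      using v by (auto simp: l2_fun_def weakly_measurable_def)
    have "(\<lambda>x. cinner (w n x) u) = (\<lambda>x. if G x \<noteq> \<infinity> then cinner (v n x) u else 0)"
      by (auto simp: w_def)
    then show ?thesis by simp
  qed
  have p_wm: "weakly_measurable M p"
    unfolding weakly_measurable_def
  proof
    fix u
    have "(\<lambda>n. cinner (w n x) u) \<longlonglongrightarrow> cinner (p x) u" for x
      unfolding cinner_eq_Complex_inner by (intro tendsto_intros wlim)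
    then show "(\<lambda>x. cinner (p x) u) \<in> borel_measurable M"
      by (intro borel_measurable_LIMSEQ_metric[OF w_meas[of _ u]])
  qed
  have lim: "AE x in M. (\<lambda>n. v n x) \<longlonglongrightarrow> p x"
    using AE_G
  proof eventually_elim
    case (elim x)
    then show ?case using wlim[of x] by (simp add: w_def)
  qed
  have close: "(\<lambda>x. p x - v n x) \<in> l2_fun M" "l2sq M (\<lambda>x. p x - v n x) \<le> (1/4)^n" for n
  proof -
    have wm: "weakly_measurable M (\<lambda>x. p x - v n x)"
      using v p_wm by (intro weakly_measurable_diff) (auto simp: l2_fun_def)
    have lim': "AE x in M. (\<lambda>m. v (m + n) x - v n x) \<longlonglongrightarrow> p x - v n x"
      using lim by eventually_elim (intro tendsto_intros LIMSEQ_ignore_initial_segment)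
    note F = Fatou_l2[OF l2_fun_diff[OF v v] wm lim' fast tendsto_const]
    show "(\<lambda>x. p x - v n x) \<in> l2_fun M" "l2sq M (\<lambda>x. p x - v n x) \<le> (1/4)^n"
      using F by simp_all
  qed
  have "p \<in> l2_fun M" using l2_fun_add[OF close(1)[of 0] v[of 0]] by simp
  from this lim close(2) show ?thesis by (rule that)
qed


section \<open>The metric space of almost everywhere classes\<close>

lemma l2_class_self: "f \<in> l2_fun M \<Longrightarrow> f \<in> l2_class M f"
  by (simp add: l2_class_def)

lemma l2_class_cong:
  assumes "AE x in M. f x = g x" shows "l2_class M f = l2_class M g"
proof -
  have "(AE x in M. h x = f x) \<longleftrightarrow> (AE x in M. h x = g x)" for h
  proof (rule eventually_subst)
    show "AE x in M. (h x = f x) = (h x = g x)" using assms by eventually_elim simp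
  qed
  then show ?thesis unfolding l2_class_def by simp
qed

lemma l2_class_eq_iff:
  assumes "f \<in> l2_fun M"
  shows "l2_class M f = l2_class M g \<longleftrightarrow> (AE x in M. f x = g x)"
proof
  assume "l2_class M f = l2_class M g"
  then have "f \<in> l2_class M g" using l2_class_self[OF assms] by simp
  then show "AE x in M. f x = g x" by (simp add: l2_class_def)
qed (rule l2_class_cong)

lemma L2_I: "f \<in> l2_fun M \<Longrightarrow> l2_class M f \<in> L2 M"
  by (simp add: L2_def)

lemma L2_memberD:
  assumes "F \<in> L2 M" "f \<in> F"
  shows "f \<in> l2_fun M" "l2_class M f = F"
proof -
  obtain g where F: "F = l2_class M g" using assms(1) unfolding L2_def by blast
  then show "f \<in> l2_fun M" using assms(2) by (simp add: l2_class_def)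
  have "AE x in M. f x = g x" using assms(2) F by (simp add: l2_class_def)
  then show "l2_class M f = F" unfolding F by (rule l2_class_cong)
qed

lemma l2_rep_in:
  assumes "F \<in> L2 M" shows "l2_rep F \<in> F"
proof -
  obtain f where "f \<in> F" using assms l2_class_self by (auto simp: L2_def)
  then show ?thesis unfolding l2_rep_def by (rule someI[of "\<lambda>f. f \<in> F"])
qed

lemma l2_rep_fun: "F \<in> L2 M \<Longrightarrow> l2_rep F \<in> l2_fun M"
  using L2_memberD(1) l2_rep_in by blast

lemma l2_class_rep: "F \<in> L2 M \<Longrightarrow> l2_class M (l2_rep F) = F"
  using L2_memberD(2) l2_rep_in by blast

lemma l2_rep_class:
  assumes "f \<in> l2_fun M" shows "AE x in M. l2_rep (l2_class M f) x = f x"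
  using l2_rep_in[OF L2_I[OF assms]] by (simp add: l2_class_def)

lemma l2_dist_eq: "l2_dist M F G = sqrt (l2sq M (\<lambda>x. l2_rep F x - l2_rep G x))"
  by (simp add: l2_dist_def l2sq_def)

lemma l2_dist_class:
  assumes "f \<in> l2_fun M" "g \<in> l2_fun M"
  shows "l2_dist M (l2_class M f) (l2_class M g) = sqrt (l2sq M (\<lambda>x. f x - g x :: 'h))"
proof -
  have "AE x in M. l2_rep (l2_class M f) x - l2_rep (l2_class M g) x = f x - g x"
    using l2_rep_class[OF assms(1)] l2_rep_class[OF assms(2)] by eventually_elim simp
  then show ?thesis
    unfolding l2_dist_eq
    by (subst l2sq_cong_AE[of _ "\<lambda>x. f x - g x"])
      (auto intro!: l2_fun_diff l2_rep_fun L2_I assms)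
qed

lemma Metric_space_L2: "Metric_space (L2 M :: ('x \<Rightarrow> 'h) set set) (l2_dist M)"
proof
  fix F G H :: "('x \<Rightarrow> 'h) set"
  show "0 \<le> l2_dist M F G" by (simp add: l2_dist_eq l2sq_nonneg)
  show "l2_dist M F G = l2_dist M G F" by (simp add: l2_dist_def norm_minus_commute)
  assume F: "F \<in> L2 M" and G: "G \<in> L2 M"
  have "l2_dist M F G = 0 \<longleftrightarrow> (AE x in M. l2_rep F x = l2_rep G x)"
    using l2sq_eq_0_iff[OF l2_fun_diff[OF l2_rep_fun[OF F] l2_rep_fun[OF G]]]
    by (simp add: l2_dist_eq)
  also have "\<dots> \<longleftrightarrow> F = G"
    using l2_class_eq_iff[OF l2_rep_fun[OF F], of "l2_rep G"] by (simp add: l2_class_rep F G)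
  finally show "l2_dist M F G = 0 \<longleftrightarrow> F = G" .
  assume H: "H \<in> L2 M"
  show "l2_dist M F H \<le> l2_dist M F G + l2_dist M G H"
    using Minkowski[OF l2_fun_diff[OF l2_rep_fun[OF F] l2_rep_fun[OF G]]
        l2_fun_diff[OF l2_rep_fun[OF G] l2_rep_fun[OF H]]]
    by (simp add: l2_dist_eq)
qed

sublocale L2: Metric_space "L2 M :: ('x \<Rightarrow> 'h) set set" "l2_dist M"
  by (rule Metric_space_L2)

lemma l2_inner_class:
  assumes f: "f \<in> l2_fun M" and g: "g \<in> l2_fun M"
  shows "l2_inner M (l2_class M f) (l2_class M g)
    = Complex (l2ip M f g) (l2ip M f (\<lambda>x. scaleC \<i> (g x) :: 'h))"
proof -
  let ?f = "l2_rep (l2_class M f)" and ?g = "l2_rep (l2_class M g)"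
  have f': "?f \<in> l2_fun M" and g': "?g \<in> l2_fun M" using f g by (auto intro: l2_rep_fun L2_I)
  have ig': "(\<lambda>x. scaleC \<i> (?g x)) \<in> l2_fun M" by (rule l2_fun_scaleC[OF g'])
  have "cinner (?f x) (?g x)
      = of_real (inner (?f x) (?g x)) + \<i> * of_real (inner (?f x) (scaleC \<i> (?g x)))" for x
    by (simp add: cinner_eq_Complex_inner Complex_eq)
  then have "l2_inner M (l2_class M f) (l2_class M g)
      = of_real (l2ip M ?f ?g) + \<i> * of_real (l2ip M ?f (\<lambda>x. scaleC \<i> (?g x)))"
    using l2ip_integrable[OF f' g'] l2ip_integrable[OF f' ig']
    by (simp add: l2_inner_def l2ip_def)
  moreover have "l2ip M ?f ?g = l2ip M f g"
    using f g f' g' by (intro l2ip_cong_AE l2_rep_class)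
  moreover have "l2ip M ?f (\<lambda>x. scaleC \<i> (?g x)) = l2ip M f (\<lambda>x. scaleC \<i> (g x))"
    using f f' ig' l2_fun_scaleC[OF g] l2_rep_class[OF g]
    by (intro l2ip_cong_AE l2_rep_class) auto
  ultimately show ?thesis by (simp add: Complex_eq)
qed

lemma l2_add_class:
  assumes "f \<in> l2_fun M" "g \<in> l2_fun M"
  shows "l2_add M (l2_class M f) (l2_class M g) = l2_class M (\<lambda>x. f x + g x)"
  unfolding l2_add_def
proof (rule l2_class_cong)
  show "AE x in M. l2_rep (l2_class M f) x + l2_rep (l2_class M g) x = f x + g x"
    using l2_rep_class[OF assms(1)] l2_rep_class[OF assms(2)] by eventually_elim simp
qed

lemma l2_diff_class:
  assumes "f \<in> l2_fun M" "g \<in> l2_fun M"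
  shows "l2_diff M (l2_class M f) (l2_class M g) = l2_class M (\<lambda>x. f x - g x)"
  unfolding l2_diff_def
proof (rule l2_class_cong)
  show "AE x in M. l2_rep (l2_class M f) x - l2_rep (l2_class M g) x = f x - g x"
    using l2_rep_class[OF assms(1)] l2_rep_class[OF assms(2)] by eventually_elim simp
qed

lemma l2_scale_class:
  assumes "f \<in> l2_fun M"
  shows "l2_scale M c (l2_class M f) = l2_class M (\<lambda>x. scaleC c (f x))"
  unfolding l2_scale_def
proof (rule l2_class_cong)
  show "AE x in M. scaleC c (l2_rep (l2_class M f) x) = scaleC c (f x)"
    using l2_rep_class[OF assms] by eventually_elim simp
qed

end

section \<open>Projection onto a closed subspace\<close>

text \<open>
  A closed subspace of classes is handled through the set of all functions representing its members,
  which is closed under almost everywhere equality; this removes the choice of representatives from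
  the Hilbert space arguments.
\<close>

locale closed_subspace_L2 = separable_hilbert_L2 M D
  for M :: "'x measure" and D :: "'h::complex_hilbert_space set" +
  fixes W :: "('x \<Rightarrow> 'h) set set"
  assumes closed_subspace: "l2_closed_subspace M W"
begin

definition member_funs :: "('x \<Rightarrow> 'h) set"
  where "member_funs = {f \<in> l2_fun M. l2_class M f \<in> W}"

lemma W_closedin: "closedin L2.mtopology W"
  using closed_subspace by (simp add: l2_closed_subspace_def l2_topology_def)

lemma W_subset: "W \<subseteq> L2 M"
  using closedin_subset[OF W_closedin] by simp

lemma member_funs_l2: "f \<in> member_funs \<Longrightarrow> f \<in> l2_fun M"
  by (simp add: member_funs_def)

lemma member_funs_zero: "(\<lambda>x. 0) \<in> member_funs"
  using closed_subspace l2_fun_zero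
  by (simp add: member_funs_def l2_closed_subspace_def l2_zero_def)

lemma member_funs_add:
  assumes "f \<in> member_funs" "g \<in> member_funs" shows "(\<lambda>x. f x + g x) \<in> member_funs"
proof -
  have fg: "f \<in> l2_fun M" "g \<in> l2_fun M" "l2_class M f \<in> W" "l2_class M g \<in> W"
    using assms by (simp_all add: member_funs_def)
  then have "l2_add M (l2_class M f) (l2_class M g) \<in> W"
    using closed_subspace by (simp add: l2_closed_subspace_def)
  then show ?thesis
    using fg by (simp add: member_funs_def l2_add_class l2_fun_add)
qed

lemma member_funs_scaleC:
  assumes "f \<in> member_funs" shows "(\<lambda>x. scaleC c (f x)) \<in> member_funs"
proof -
  have f: "f \<in> l2_fun M" "l2_class M f \<in> W"
    using assms by (simp_all add: member_funs_def)
  then have "l2_scale M c (l2_class M f) \<in> W"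
    using closed_subspace by (simp add: l2_closed_subspace_def)
  then show ?thesis
    using f by (simp add: member_funs_def l2_scale_class l2_fun_scaleC)
qed

lemma member_funs_scaleR: "f \<in> member_funs \<Longrightarrow> (\<lambda>x. t *\<^sub>R f x) \<in> member_funs"
  using member_funs_scaleC[of f "complex_of_real t"] by (simp add: scaleC_of_real)

lemma member_funs_diff:
  assumes "f \<in> member_funs" "g \<in> member_funs" shows "(\<lambda>x. f x - g x) \<in> member_funs"
  using member_funs_add[OF assms(1) member_funs_scaleR[OF assms(2), of "-1"]] by simp

lemma member_funs_closed:
  assumes v: "\<And>n. v n \<in> member_funs" and p: "p \<in> l2_fun M"
    and lim: "(\<lambda>n. l2sq M (\<lambda>x. p x - v n x)) \<longlonglongrightarrow> 0"
  shows "p \<in> member_funs"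
proof -
  have "l2_dist M (l2_class M (v n)) (l2_class M p) = sqrt (l2sq M (\<lambda>x. p x - v n x))" for n
    using l2_dist_class[OF p member_funs_l2[OF v]] by (simp add: L2.commute)
  moreover have "(\<lambda>n. sqrt (l2sq M (\<lambda>x. p x - v n x))) \<longlonglongrightarrow> sqrt 0"
    by (intro tendsto_intros lim)
  ultimately have "limitin L2.mtopology (\<lambda>n. l2_class M (v n)) (l2_class M p) sequentially"
    unfolding L2.limitin_metric_dist_null by (simp add: L2_I p member_funs_l2[OF v])
  moreover have "range (\<lambda>n. l2_class M (v n)) \<subseteq> W"
    using v by (auto simp: member_funs_def)
  ultimately have "l2_class M p \<in> W"
    using W_closedin unfolding L2.metric_closedin_iff_sequentially_closed by blast
  then show ?thesis using p by (simp add: member_funs_def)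
qed

text \<open>
  The subspace is invariant under multiplication by \<open>\<i>\<close>, so orthogonality for the complex inner
  product is already decided by its real part.
\<close>

lemma orthogonal_iff_l2ip:
  assumes f: "f \<in> l2_fun M"
  shows "(\<forall>G\<in>W. l2_inner M (l2_class M f) G = 0) \<longleftrightarrow> (\<forall>g\<in>member_funs. l2ip M f g = 0)"
proof (intro iffI ballI)
  fix g assume *: "\<forall>G\<in>W. l2_inner M (l2_class M f) G = 0" and g: "g \<in> member_funs"
  then have "l2_inner M (l2_class M f) (l2_class M g) = 0" by (simp add: member_funs_def)
  then show "l2ip M f g = 0"
    by (simp add: l2_inner_class[OF f member_funs_l2[OF g]] complex_eq_iff)
next
  fix G assume *: "\<forall>g\<in>member_funs. l2ip M f g = 0" and G: "G \<in> W"
  let ?g = "l2_rep G"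
  have GL: "G \<in> L2 M" using G W_subset by blast
  have g: "?g \<in> member_funs"
    using G GL by (simp add: member_funs_def l2_rep_fun l2_class_rep)
  show "l2_inner M (l2_class M f) G = 0"
    using l2_inner_class[OF f l2_rep_fun[OF GL]] * g member_funs_scaleC[OF g]
    by (simp add: l2_class_rep[OF GL] complex_eq_iff)
qed

definition is_projection :: "('x \<Rightarrow> 'h) \<Rightarrow> ('x \<Rightarrow> 'h) \<Rightarrow> bool"
  where "is_projection \<xi> p \<longleftrightarrow> p \<in> member_funs \<and> (\<forall>g\<in>member_funs. l2ip M (\<lambda>x. \<xi> x - p x) g = 0)"

lemma is_projection_cong_AE:
  assumes \<xi>: "\<xi> \<in> l2_fun M" and p: "is_projection \<xi> p"
    and q: "q \<in> l2_fun M" and eq: "AE x in M. q x = p x"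
  shows "is_projection \<xi> q"
proof -
  have p': "p \<in> member_funs" using p by (simp add: is_projection_def)
  have "q \<in> member_funs" using p' q l2_class_cong[OF eq] by (simp add: member_funs_def)
  moreover have "l2ip M (\<lambda>x. \<xi> x - q x) g = l2ip M (\<lambda>x. \<xi> x - p x) g" if "g \<in> member_funs" for g
    using eq by (intro l2ip_cong_AE l2_fun_diff \<xi> q member_funs_l2 p' that) auto
  ultimately show ?thesis using p by (simp add: is_projection_def)
qed

text \<open>
  A sequence in the subspace whose squared distances to \<open>\<xi>\<close> come within \<open>(1/4)\<^sup>n\<^sup>+\<^sup>1\<close> of the infimum
  is Cauchy at the rate needed for completeness, by the parallelogram law; its limit attains the
  infimum, and minimality along the lines \<open>p + t g\<close> is orthogonality.
\<close>

lemma projection_exists: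
  assumes \<xi>: "\<xi> \<in> l2_fun M"
  obtains p where "is_projection \<xi> p"
proof -
  define E where "E v = l2sq M (\<lambda>x. \<xi> x - v x)" for v
  define d where "d = (INF v\<in>member_funs. E v)"
  have bdd: "bdd_below (E ` member_funs)"
    by (rule bdd_belowI[of _ 0]) (auto simp: E_def l2sq_nonneg)
  have d_le: "d \<le> E v" if "v \<in> member_funs" for v
    unfolding d_def by (rule cINF_lower[OF bdd that])
  have "\<exists>v\<in>member_funs. E v < d + (1/4)^Suc n" for n
    using member_funs_zero cINF_less_iff[OF _ bdd, of "d + (1/4)^Suc n"] unfolding d_def by force
  then obtain v where v: "\<And>n. v n \<in> member_funs" and Ev: "\<And>n. E (v n) < d + (1/4)^Suc n"
    by metis
  have fast: "l2sq M (\<lambda>x. v m x - v n x) \<le> (1/4)^n" if "n \<le> m" for n m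
  proof -
    let ?a = "\<lambda>x. \<xi> x - v n x" and ?b = "\<lambda>x. \<xi> x - v m x"
    have ab: "?a \<in> l2_fun M" "?b \<in> l2_fun M" using \<xi> v by (auto intro: l2_fun_diff member_funs_l2)
    have mid: "(\<lambda>x. (1/2) *\<^sub>R (v n x + v m x)) \<in> member_funs"
      by (intro member_funs_scaleR member_funs_add v)
    have "(\<lambda>x. ?a x + 1 *\<^sub>R ?b x) = (\<lambda>x. 2 *\<^sub>R (\<xi> x - (1/2) *\<^sub>R (v n x + v m x)))"
      by (simp add: fun_eq_iff algebra_simps scaleR_2)
    then have "l2sq M (\<lambda>x. ?a x + 1 *\<^sub>R ?b x) = 4 * E (\<lambda>x. (1/2) *\<^sub>R (v n x + v m x))"
      by (simp add: E_def l2sq_def power_mult_distrib)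
    then have "4 * d \<le> l2sq M (\<lambda>x. ?a x + 1 *\<^sub>R ?b x)" using d_le[OF mid] by simp
    moreover have "l2sq M (\<lambda>x. ?a x + (-1) *\<^sub>R ?b x) = l2sq M (\<lambda>x. v m x - v n x)"
      by (simp add: algebra_simps)
    ultimately have "l2sq M (\<lambda>x. v m x - v n x) \<le> 2 * E (v n) + 2 * E (v m) - 4 * d"
      using l2sq_add_scaleR[OF ab, of 1] l2sq_add_scaleR[OF ab, of "-1"] by (simp add: E_def)
    also have "\<dots> \<le> (1/4)^n / 2 + (1/4)^m / 2" using Ev[of n] Ev[of m] by simp
    also have "\<dots> \<le> (1/4)^n" using power_decreasing[OF that, of "1/4::real"] by argo
    finally show ?thesis .
  qed
  obtain p where p: "p \<in> l2_fun M" "AE x in M. (\<lambda>n. v n x) \<longlonglongrightarrow> p x"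
    and close: "\<And>n. l2sq M (\<lambda>x. p x - v n x) \<le> (1/4)^n"
    using Riesz_Fischer[OF member_funs_l2[OF v] fast] by blast
  have geom: "(\<lambda>n. (1/4::real)^n) \<longlonglongrightarrow> 0" by (intro LIMSEQ_power_zero) simp
  have pV: "p \<in> member_funs"
    using v p(1)
  proof (rule member_funs_closed)
    show "(\<lambda>n. l2sq M (\<lambda>x. p x - v n x)) \<longlonglongrightarrow> 0"
      by (rule tendsto_sandwich[OF _ _ tendsto_const geom]) (auto simp: l2sq_nonneg close)
  qed
  have Ep: "E p \<le> d"
    unfolding E_def
  proof (rule Fatou_l2(2))
    show "(\<lambda>x. \<xi> x - v n x) \<in> l2_fun M" for n by (intro l2_fun_diff \<xi> member_funs_l2 v)
    show "weakly_measurable M (\<lambda>x. \<xi> x - p x)" using l2_fun_diff[OF \<xi> p(1)] by (simp add: l2_fun_def)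
    show "AE x in M. (\<lambda>n. \<xi> x - v n x) \<longlonglongrightarrow> \<xi> x - p x"
      using p(2) by eventually_elim (intro tendsto_intros)
    show "l2sq M (\<lambda>x. \<xi> x - v n x) \<le> d + (1/4)^Suc n" for n using Ev[of n] by (simp add: E_def)
    have "(\<lambda>n. d + (1/4)^Suc n) \<longlonglongrightarrow> d + 0"
      by (rule tendsto_add[OF tendsto_const LIMSEQ_Suc[OF geom]])
    then show "(\<lambda>n. d + (1/4)^Suc n) \<longlonglongrightarrow> d" by simp
  qed
  have "l2ip M (\<lambda>x. \<xi> x - p x) g = 0" if g: "g \<in> member_funs" for g
  proof -
    have "0 \<le> 0 + 2 * t * l2ip M (\<lambda>x. \<xi> x - p x) g + t\<^sup>2 * l2sq M g" for t
    proof -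
      have "(\<lambda>x. p x - t *\<^sub>R g x) \<in> member_funs" by (intro member_funs_diff member_funs_scaleR pV g)
      then have "E p \<le> E (\<lambda>x. p x - t *\<^sub>R g x)" using d_le Ep by force
      also have "\<dots> = l2sq M (\<lambda>x. (\<xi> x - p x) + t *\<^sub>R g x)" by (simp add: E_def algebra_simps)
      also have "\<dots> = E p + 2 * t * l2ip M (\<lambda>x. \<xi> x - p x) g + t\<^sup>2 * l2sq M g"
        unfolding E_def by (intro l2sq_add_scaleR l2_fun_diff \<xi> p(1) member_funs_l2 g)
      finally show ?thesis by simp
    qed
    from nonneg_quadratic_discriminant[OF this] show ?thesis by simp
  qed
  then show ?thesis using pV by (intro that[of p]) (simp add: is_projection_def)
qed

text \<open>
  The difference of the errors \<open>\<xi> - p\<close> and \<open>\<eta> - q\<close> is orthogonal to \<open>p - q\<close>, and the two add up to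
  \<open>\<xi> - \<eta>\<close>; the claim is Pythagoras. With \<open>\<eta> = \<xi>\<close> it also gives uniqueness of the projection.
\<close>

lemma projection_contractive:
  assumes \<xi>: "\<xi> \<in> l2_fun M" and p: "is_projection \<xi> p"
    and \<eta>: "\<eta> \<in> l2_fun M" and q: "is_projection \<eta> q"
  shows "l2sq M (\<lambda>x. p x - q x) \<le> l2sq M (\<lambda>x. \<xi> x - \<eta> x)"
proof -
  let ?w = "\<lambda>x. p x - q x" and ?r = "\<lambda>x. (\<xi> x - p x) - (\<eta> x - q x)"
  have pq: "p \<in> member_funs" "q \<in> member_funs" using p q by (auto simp: is_projection_def)
  have w: "?w \<in> member_funs" by (rule member_funs_diff[OF pq])
  have a: "(\<lambda>x. \<xi> x - p x) \<in> l2_fun M" and b: "(\<lambda>x. \<eta> x - q x) \<in> l2_fun M"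
    using \<xi> \<eta> pq by (auto intro: l2_fun_diff member_funs_l2)
  have "l2ip M ?r ?w = 0"
    using p q w by (simp add: l2ip_diff_left[OF a b member_funs_l2[OF w]] is_projection_def)
  then have "l2sq M (\<lambda>x. ?r x + 1 *\<^sub>R ?w x) = l2sq M ?r + l2sq M ?w"
    using l2sq_add_scaleR[OF l2_fun_diff[OF a b] member_funs_l2[OF w], of 1] by simp
  moreover have "(\<lambda>x. ?r x + 1 *\<^sub>R ?w x) = (\<lambda>x. \<xi> x - \<eta> x)" by (simp add: fun_eq_iff)
  ultimately show ?thesis using l2sq_nonneg[of ?r] by simp
qed

lemma l2_proj_eq_class:
  assumes \<xi>: "\<xi> \<in> L2 M" and p: "is_projection (l2_rep \<xi>) p"
  shows "l2_proj M W \<xi> = l2_class M p"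
proof -
  have orth_iff: "(\<forall>G\<in>W. l2_inner M (l2_diff M \<xi> (l2_class M q)) G = 0)
      \<longleftrightarrow> (\<forall>g\<in>member_funs. l2ip M (\<lambda>x. l2_rep \<xi> x - q x) g = 0)" if q: "q \<in> l2_fun M" for q
    using l2_diff_class[OF l2_rep_fun[OF \<xi>] q]
      orthogonal_iff_l2ip[OF l2_fun_diff[OF l2_rep_fun[OF \<xi>] q]]
    by (simp add: l2_class_rep[OF \<xi>])
  have p': "p \<in> member_funs" using p by (simp add: is_projection_def)
  show ?thesis
    unfolding l2_proj_def
  proof (rule the_equality)
    show "l2_class M p \<in> W \<and> (\<forall>G\<in>W. l2_inner M (l2_diff M \<xi> (l2_class M p)) G = 0)"
      using p orth_iff[OF member_funs_l2[OF p']] by (simp add: is_projection_def member_funs_def)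
  next
    fix Q assume Q: "Q \<in> W \<and> (\<forall>G\<in>W. l2_inner M (l2_diff M \<xi> Q) G = 0)"
    have QL: "Q \<in> L2 M" using Q W_subset by blast
    let ?q = "l2_rep Q"
    have "?q \<in> member_funs" using Q QL by (simp add: member_funs_def l2_rep_fun l2_class_rep)
    then have q: "is_projection (l2_rep \<xi>) ?q"
      using Q orth_iff[OF l2_rep_fun[OF QL]] by (simp add: is_projection_def l2_class_rep[OF QL])
    have "l2sq M (\<lambda>x. ?q x - p x) \<le> l2sq M (\<lambda>x. l2_rep \<xi> x - l2_rep \<xi> x)"
      using l2_rep_fun[OF \<xi>] by (intro projection_contractive p q)
    then have "l2sq M (\<lambda>x. ?q x - p x) = 0"
      by (intro order.antisym l2sq_nonneg) (simp add: l2sq_def)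
    then have "AE x in M. ?q x = p x"
      using l2sq_eq_0_iff[OF l2_fun_diff[OF l2_rep_fun[OF QL] member_funs_l2[OF p']]] by simp
    then show "Q = l2_class M p"
      using l2_class_cong l2_class_rep[OF QL] by metis
  qed
qed

lemma l2_proj_member:
  assumes \<Phi>: "\<Phi> \<in> L2 M" and g: "g \<in> l2_proj M W \<Phi>"
  shows "is_projection (l2_rep \<Phi>) g"
proof -
  obtain p where p: "is_projection (l2_rep \<Phi>) p"
    using projection_exists[OF l2_rep_fun[OF \<Phi>]] .
  have "g \<in> l2_class M p" using g l2_proj_eq_class[OF \<Phi> p] by simp
  then show ?thesis
    by (intro is_projection_cong_AE[OF l2_rep_fun[OF \<Phi>] p]) (auto simp: l2_class_def)
qed

lemma AE_tendsto_of_fast_l2: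
  assumes p: "p \<in> l2_fun M" and v: "\<And>n. v n \<in> l2_fun M"
    and fast: "\<And>n. l2sq M (\<lambda>x. v n x - p x) \<le> (1/4)^n"
  shows "AE x in M. (\<lambda>n. v n x) \<longlonglongrightarrow> (p x :: 'h)"
  using AE_summable_of_fast_decay[OF l2_fun_diff[OF v p] fast]
proof eventually_elim
  case (elim x)
  then obtain B where B: "\<And>n. norm (v n x - p x) \<le> B * sqrt (1/2)^n"
    using norm_geometric_of_weighted_sum[of "\<lambda>n. v n x - p x"] by metis
  have "(\<lambda>n. B * sqrt (1/2)^n) \<longlonglongrightarrow> B * 0"
    by (intro tendsto_intros LIMSEQ_power_zero) simp
  then have lim: "(\<lambda>n. B * sqrt (1/2)^n) \<longlonglongrightarrow> 0" by simp
  have "(\<lambda>n. v n x - p x) \<longlonglongrightarrow> 0"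
    by (rule Lim_null_comparison[OF _ lim]) (simp add: B)
  then show ?case by (simp add: LIM_zero_iff)
qed

text \<open>
  Approximating \<open>\<xi>\<close> fast by members of the dense set and using that the projection is contractive,
  the chosen representatives converge to the projection almost everywhere, not only in mean;
  hence its values are limits of vectors that span the range function.
\<close>

lemma projection_in_range_function:
  assumes \<xi>: "\<xi> \<in> L2 M" and p: "is_projection (l2_rep \<xi>) p"
    and A: "A \<subseteq> L2 M" and dense: "l2_topology M closure_of A = L2 M"
    and f: "\<And>\<Phi>. \<Phi> \<in> A \<Longrightarrow> f \<Phi> \<in> l2_proj M W \<Phi>"
  shows "AE x in M. p x \<in> range_function A f x"
proof -
  have "\<exists>\<Phi>\<in>A. l2_dist M \<xi> \<Phi> < (1/2)^n" for n
  proof -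
    have "\<xi> \<in> L2.mtopology closure_of A" using dense \<xi> by (simp add: l2_topology_def)
    then have "\<forall>r>0. \<exists>\<Phi>\<in>A. \<Phi> \<in> L2.mball \<xi> r" unfolding L2.metric_closure_of by blast
    then show ?thesis by (metis L2.in_mball half_gt_zero zero_less_one zero_less_power)
  qed
  then obtain \<Phi> where \<Phi>: "\<And>n. \<Phi> n \<in> A" and near: "\<And>n. l2_dist M \<xi> (\<Phi> n) < (1/2)^n"
    by metis
  have \<Phi>L: "\<Phi> n \<in> L2 M" for n using \<Phi> A by blast
  have fp: "is_projection (l2_rep (\<Phi> n)) (f (\<Phi> n))" for n
    by (rule l2_proj_member[OF \<Phi>L f[OF \<Phi>]])
  have fast: "l2sq M (\<lambda>x. f (\<Phi> n) x - p x) \<le> (1/4)^n" for n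
  proof -
    let ?s = "l2sq M (\<lambda>x. l2_rep (\<Phi> n) x - l2_rep \<xi> x)"
    have "sqrt ?s \<le> (1/2)^n" using near[of n] L2.commute[of \<xi> "\<Phi> n"] by (simp add: l2_dist_eq)
    then have "(sqrt ?s)\<^sup>2 \<le> ((1/2)^n)\<^sup>2" by (intro power_mono) (auto simp: l2sq_nonneg)
    also have "\<dots> = (1/4)^n" by (simp add: power2_eq_square flip: power_mult_distrib)
    finally have "?s \<le> (1/4)^n" by (simp add: l2sq_nonneg)
    moreover have "l2sq M (\<lambda>x. f (\<Phi> n) x - p x) \<le> ?s"
      by (intro projection_contractive l2_rep_fun \<Phi>L \<xi> fp p)
    ultimately show ?thesis by simp
  qed
  have "AE x in M. (\<lambda>n. f (\<Phi> n) x) \<longlonglongrightarrow> p x"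
    using p fp by (intro AE_tendsto_of_fast_l2 fast member_funs_l2) (auto simp: is_projection_def)
  then show ?thesis
  proof eventually_elim
    case (elim x)
    have mem: "f (\<Phi> n) x \<in> range_function A f x" for n
      unfolding range_function_def using \<Phi>[of n]
      by (intro closure_subset[THEN subsetD] complex_vector.span_base) blast
    have "closed (range_function A f x)" by (simp add: range_function_def)
    from closed_sequentially[OF this mem elim] show ?case .
  qed
qed

text \<open>
  The pointwise projection is never constructed: a representative \<open>p\<close> of the global projection
  already has the two properties that characterise \<open>P\<^sub>J(x) \<xi>(x)\<close> at almost every point.
\<close>

lemma l2_proj_eq_direct_integral:
  assumes \<xi>: "\<xi> \<in> L2 M"
    and A: "A \<subseteq> L2 M" and dense: "l2_topology M closure_of A = L2 M"
    and f: "\<And>\<Phi>. \<Phi> \<in> A \<Longrightarrow> f \<Phi> \<in> l2_proj M W \<Phi>"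
    and oc: "orthogonality_condition M W (range_function A f)"
  shows "l2_proj M W \<xi> = direct_integral M (\<lambda>x. orth_proj (range_function A f x)) \<xi>"
proof -
  obtain p where p: "is_projection (l2_rep \<xi>) p"
    using projection_exists[OF l2_rep_fun[OF \<xi>]] .
  let ?r = "\<lambda>x. l2_rep \<xi> x - p x"
  have r: "?r \<in> l2_fun M"
    using p by (intro l2_fun_diff l2_rep_fun \<xi> member_funs_l2) (simp add: is_projection_def)
  have "\<forall>G\<in>W. l2_inner M (l2_class M ?r) G = 0"
    using p orthogonal_iff_l2ip[OF r] by (simp add: is_projection_def)
  then have orth: "AE x in M. \<forall>v\<in>range_function A f x. cinner (l2_rep (l2_class M ?r) x) v = 0"
    using oc L2_I[OF r] by (simp add: orthogonality_condition_def)
  have range: "AE x in M. p x \<in> range_function A f x"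
    using f by (rule projection_in_range_function[OF \<xi> p A dense])
  have "AE x in M. p x = orth_proj (range_function A f x) (l2_rep \<xi> x)"
    using orth l2_rep_class[OF r] range
  proof eventually_elim
    case (elim x)
    then show ?case by (intro orth_proj_eqI[symmetric]) auto
  qed
  then show ?thesis
    unfolding direct_integral_def l2_proj_eq_class[OF \<xi> p] by (rule l2_class_cong)
qed

end

theorem corollary3p8p20:
  fixes M :: "'x measure"
    and A W :: "('x \<Rightarrow> 'h::complex_hilbert_space) set set"
    and f :: "('x \<Rightarrow> 'h) set \<Rightarrow> 'x \<Rightarrow> 'h"
  assumes "complete_measure M"
    and "sigma_finite_measure M"
    and "separable_space (l2_topology M :: ('x \<Rightarrow> complex) set topology)"
    and "separable_space (euclidean :: 'h topology)"
    and "countable A"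
    and "A \<subseteq> L2 M"
    and "l2_topology M closure_of A = L2 M"
    and "l2_closed_subspace M W"
    and "\<And>\<Phi>. \<Phi> \<in> A \<Longrightarrow> f \<Phi> \<in> l2_proj M W \<Phi>"
    and "orthogonality_condition M W (range_function A f)"
  shows "\<forall>\<xi>\<in>L2 M. l2_proj M W \<xi> =
    direct_integral M (\<lambda>x. orth_proj (range_function A f x)) \<xi>"
proof -
  obtain D :: "'h set" where "countable D" "closure D = UNIV"
    using assms(4) by (auto simp: separable_space_def)
  then interpret closed_subspace_L2 M D W
    using assms(8) by unfold_locales
  show ?thesis
    using assms(6,7,9,10) by (intro ballI l2_proj_eq_direct_integral)
qed

end
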